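(* Let $M$ be a matroid on a finite ground set $E$ with rank function $r$, and let $\ell:E\to\mathbb{N}$ and $w:E\to\mathbb{N}$ be functions (list size and weight). Then the following conditions are equivalent: (1) for each $A\subset E$ we have $\sum_{i\in\mathbb{N}_{+}} r(\{e\in A:\ell(e)\geq i\})\geq\sum_{e\in A}w(e)$; (2) the matroid $M$ is $w$-colorable from the lists $L_{\ell}(e)=\{1,\dots,\ell(e)\}$, $e\in E$; (3) the matroid $M$ is $w$-colorable from any lists of size $\ell$, that is, from every list assignment $L:E\to\mathcal{P}(\mathbb{N})$ with $|L(e)|=\ell(e)$ for each $e\in E$.
   Context: $\mathbb{N}$ contains $0$ and $\mathbb{N}_+=\{1,2,3,\dots\}$. A list assignment is a function $L:E\to\mathcal{P}(\mathbb{N})$; its size is the function $e\mapsto|L(e)|$. For a weight function $w:E\to\mathbb{N}$ and a list assignment $L$, the matroid $M$ is called $w$-colorable from lists $L$ if one can choose for each $e\in E$ a subset $L'(e)\subset L(e)$ with exactly $w(e)$ colors, such that for each color $c$ the set $\{e\in E: c\in L'(e)\}$ is independent in $M$. *)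

theory Defs
  imports "HOL-Analysis.Infinite_Sum"
begin

locale matroid =
  fixes E :: "'a set" and indep :: "'a set \<Rightarrow> bool"
  assumes finite_ground: "finite E"
    and indep_subset_ground: "indep X \<Longrightarrow> X \<subseteq> E"
    and indep_empty: "indep {}"
    and indep_subset: "indep X \<Longrightarrow> Y \<subseteq> X \<Longrightarrow> indep Y"
    and indep_augment:
      "indep X \<Longrightarrow> indep Y \<Longrightarrow> card X < card Y \<Longrightarrow> \<exists>y\<in>Y - X. indep (insert y X)"

text \<open>The rank is meaningful for subsets of the ground set of a matroid: there the set under
  \<^const>\<open>Max\<close> is finite and, as the empty set is independent, nonempty.\<close>

definition matroid_rank :: "('a set \<Rightarrow> bool) \<Rightarrow> 'a set \<Rightarrow> nat" where
  "matroid_rank indep A = Max {card X | X. X \<subseteq> A \<and> indep X}"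

text \<open>Finiteness of \<open>L' e\<close> is explicit because \<^const>\<open>card\<close> is 0 on infinite sets, while
  the lists \<open>L e\<close> may be infinite in this definition.\<close>

definition colorable_from_lists ::
  "'a set \<Rightarrow> ('a set \<Rightarrow> bool) \<Rightarrow> ('a \<Rightarrow> nat) \<Rightarrow> ('a \<Rightarrow> nat set) \<Rightarrow> bool" where
  "colorable_from_lists E indep w L \<longleftrightarrow>
     (\<exists>L'. (\<forall>e\<in>E. L' e \<subseteq> L e \<and> finite (L' e) \<and> card (L' e) = w e) \<and>
           (\<forall>c. indep {e \<in> E. c \<in> L' e}))"

definition list_assignment_of_size ::
  "'a set \<Rightarrow> ('a \<Rightarrow> nat) \<Rightarrow> ('a \<Rightarrow> nat set) \<Rightarrow> bool" where
  "list_assignment_of_size E l L \<longleftrightarrow> (\<forall>e\<in>E. finite (L e) \<and> card (L e) = l e)"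

text \<open>The rank sum over all positive integers has only finitely many nonzero terms, so
  \<^const>\<open>infsum\<close> yields its actual value.\<close>

lemma (in matroid) infsum_rank_eq_sum:
  fixes l :: "'a \<Rightarrow> nat"
  assumes "\<And>e. e \<in> A \<Longrightarrow> l e \<le> n"
  shows "(\<Sum>\<^sub>\<infinity>i\<in>{1..}. matroid_rank indep {e \<in> A. i \<le> l e})
       = (\<Sum>i=1..n. matroid_rank indep {e \<in> A. i \<le> l e})"
proof -
  have "matroid_rank indep {e \<in> A. i \<le> l e} = 0" if "i \<in> {1..} - {1..n}" for i
  proof -
    have *: "{e \<in> A. i \<le> l e} = {}" using that assms by fastforce
    have "{card X | X. X \<subseteq> {} \<and> indep X} = {0}" using indep_empty by auto
    then show ?thesis unfolding * matroid_rank_def by simp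
  qed
  then have "infsum (\<lambda>i. matroid_rank indep {e \<in> A. i \<le> l e}) {1..}
           = infsum (\<lambda>i. matroid_rank indep {e \<in> A. i \<le> l e}) {1..n}"
    by (intro infsum_cong_neutral) auto
  then show ?thesis by simp
qed

end

theory Submission
  imports Defs
begin

text \<open>
  The equivalence rests on a criterion for colorability from one fixed finite list assignment
  \<open>L\<close> with colors in a finite set \<open>C\<close>: a coloring exists iff
  \[ \sum_{e \in A} w(e) \le \sum_{c \in C} r(\{e \in A : c \in L(e)\}) \]
  for every \<open>A \<subseteq> E\<close> (\<open>colorable_iff_rank_sum\<close>). Necessity is double counting. Sufficiency
  is Rado's theorem on independent transversals. Make \<open>w(e)\<close> copies of each element \<open>e\<close>, and
  let every copy choose a pair \<open>(c, e)\<close> with \<open>c \<in> L(e)\<close>. The pairs carry the direct sum of one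
  copy of the matroid per color, whose rank function adds up the ranks of the color classes, and
  the displayed inequality is Rado's condition. An independent transversal picks \<open>w(e)\<close>
  different colors for \<open>e\<close> and makes every color class independent.

  For the lists \<open>{1..l e}\<close> the right-hand side above is exactly the sum in condition (1), so (1)
  and (2) are equivalent. For arbitrary lists of the same sizes the right-hand side is at least as
  large: the lists \<open>{1..l e}\<close> replace the color classes by the nested chain of the sets of
  elements lying in at least \<open>i\<close> of them, and such uncrossing never increases the sum of a
  submodular function (\<open>sum_threshold_sets_le\<close>). Hence (1) implies the criterion for every list
  assignment of size \<open>l\<close>, which is (3), and (3) has (2) as a special case.
\<close>

section \<open>Rado's theorem for monotone submodular functions\<close>

text \<open>
  While some set \<open>A i\<close> has two elements \<open>x \<noteq> y\<close>, one of them can be deleted without violating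
  the condition: if \<open>J1\<close> and \<open>J2\<close> witness that both deletions fail, both contain \<open>i\<close>, and
  submodularity applied to the two unions yields, through the index sets \<open>J1 \<union> J2\<close> and
  \<open>J1 \<inter> J2 - {i}\<close>, a bound that is off by one. Once all the sets are singletons they
  constitute the transversal.
\<close>

theorem rado_transversal:
  fixes \<rho> :: "'s set \<Rightarrow> nat" and A :: "'i \<Rightarrow> 's set"
  assumes empty: "\<rho> {} = 0"
    and mono: "\<And>X Y. X \<subseteq> Y \<Longrightarrow> \<rho> X \<le> \<rho> Y"
    and submodular: "\<And>X Y. \<rho> (X \<union> Y) + \<rho> (X \<inter> Y) \<le> \<rho> X + \<rho> Y"
    and finite_index: "finite I"
    and "\<And>i. i \<in> I \<Longrightarrow> finite (A i)"
    and "\<And>J. J \<subseteq> I \<Longrightarrow> card J \<le> \<rho> (\<Union>i\<in>J. A i)"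
  shows "\<exists>f. (\<forall>i\<in>I. f i \<in> A i) \<and> (\<forall>J\<subseteq>I. card J \<le> \<rho> (f ` J))"
  using assms(5,6)
proof (induction "\<Sum>i\<in>I. card (A i)" arbitrary: A rule: less_induct)
  case less
  note fin = less.prems(1) and cond = less.prems(2)
  show ?case
  proof (cases "\<exists>i\<in>I. \<exists>x\<in>A i. \<exists>y\<in>A i. x \<noteq> y")
    case False
    have nonempty: "A i \<noteq> {}" if "i \<in> I" for i
      using cond[of "{i}"] that empty by auto
    define f where "f i = (SOME x. x \<in> A i)" for i
    have f: "f i \<in> A i" if "i \<in> I" for i
      unfolding f_def using nonempty[OF that] by (simp add: some_in_eq)
    have "A i = {f i}" if "i \<in> I" for i
      using f[OF that] False that by blast
    then have "(\<Union>i\<in>J. A i) = f ` J" if "J \<subseteq> I" for J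
      using that by auto
    then show ?thesis using f cond by metis
  next
    case True
    then obtain i x y where i: "i \<in> I" and x: "x \<in> A i" and y: "y \<in> A i" and "x \<noteq> y"
      by blast
    define del where "del z = A(i := A i - {z})" for z
    have del_subset: "del z j \<subseteq> A j" for z j
      by (auto simp: del_def)
    have step: ?thesis
      if z: "z \<in> A i" and del_cond: "\<And>J. J \<subseteq> I \<Longrightarrow> card J \<le> \<rho> (\<Union>j\<in>J. del z j)" for z
    proof -
      have "(\<Sum>j\<in>I. card (del z j)) < (\<Sum>j\<in>I. card (A j))"
      proof (rule sum_strict_mono_ex1[OF finite_index])
        show "\<forall>j\<in>I. card (del z j) \<le> card (A j)"
          using fin del_subset by (simp add: card_mono)
        have "card (del z i) < card (A i)"
          using fin[OF i] z unfolding del_def by (simp add: card_Diff1_less del: card_Diff_insert)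
        then show "\<exists>j\<in>I. card (del z j) < card (A j)" using i by blast
      qed
      moreover have "finite (del z j)" if "j \<in> I" for j
        using fin[OF that] del_subset finite_subset by metis
      ultimately obtain f where "\<forall>j\<in>I. f j \<in> del z j" "\<forall>J\<subseteq>I. card J \<le> \<rho> (f ` J)"
        using less.hyps[of "del z"] del_cond by blast
      then show ?thesis using del_subset by blast
    qed
    have contains_i: "i \<in> J"
      if "J \<subseteq> I" "\<not> card J \<le> \<rho> (\<Union>j\<in>J. del z j)" for J z
    proof (rule ccontr)
      assume "i \<notin> J"
      then have "(\<Union>j\<in>J. del z j) = (\<Union>j\<in>J. A j)"
        by (auto simp: del_def)
      then show False using cond[OF that(1)] that(2) by simp
    qed
    show ?thesis
    proof (rule ccontr)
      assume contra: "\<not> ?thesis"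
      obtain J1 where J1: "J1 \<subseteq> I" "\<not> card J1 \<le> \<rho> (\<Union>j\<in>J1. del x j)"
        using contra step[OF x] by blast
      obtain J2 where J2: "J2 \<subseteq> I" "\<not> card J2 \<le> \<rho> (\<Union>j\<in>J2. del y j)"
        using contra step[OF y] by blast
      note i1 = contains_i[OF J1] and i2 = contains_i[OF J2]
      have fin12: "finite J1" "finite J2"
        using J1(1) J2(1) finite_index finite_subset by auto
      let ?U = "\<Union>j\<in>J1. del x j" and ?V = "\<Union>j\<in>J2. del y j"
      have "card (J1 \<union> J2) \<le> \<rho> (\<Union>j\<in>J1 \<union> J2. A j)"
        using cond[of "J1 \<union> J2"] J1(1) J2(1) by blast
      also have "\<dots> \<le> \<rho> (?U \<union> ?V)"
      proof (rule mono, rule subsetI)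
        fix u assume "u \<in> (\<Union>j\<in>J1 \<union> J2. A j)"
        then obtain j where "j \<in> J1 \<union> J2" "u \<in> A j" by blast
        then show "u \<in> ?U \<union> ?V"
          using i1 i2 \<open>x \<noteq> y\<close> by (cases "j = i"; cases "u = x") (auto simp: del_def)
      qed
      finally have union: "card (J1 \<union> J2) \<le> \<rho> (?U \<union> ?V)" .
      have "card (J1 \<inter> J2 - {i}) \<le> \<rho> (\<Union>j\<in>J1 \<inter> J2 - {i}. A j)"
        using cond J1(1) by (meson Diff_subset inf_le1 order_trans)
      also have "\<dots> \<le> \<rho> (?U \<inter> ?V)"
        by (rule mono) (auto simp: del_def)
      finally have inter: "card (J1 \<inter> J2 - {i}) \<le> \<rho> (?U \<inter> ?V)" .
      have "card (J1 \<inter> J2) = Suc (card (J1 \<inter> J2 - {i}))"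
        using i1 i2 fin12 card_Suc_Diff1[of "J1 \<inter> J2" i] by simp
      moreover have "card (J1 \<union> J2) + card (J1 \<inter> J2) = card J1 + card J2"
        using fin12 by (simp only: card_Un_Int[of J1 J2])
      ultimately show False
        using union inter submodular[of ?U ?V] J1(2) J2(2) by linarith
    qed
  qed
qed

section \<open>Uncrossing to threshold sets\<close>

text \<open>
  Here \<open>T 1 \<supseteq> T 2 \<supseteq> \<dots>\<close> are the threshold sets of a family, and \<open>T i \<union> (T (i - 1) \<inter> X)\<close> is the
  \<open>i\<close>-th threshold set after adding \<open>X\<close>. Uncrossing \<open>X\<close> with \<open>T 1\<close>, the resulting intersection
  with \<open>T 2\<close>, and so on, each step keeps the union and passes on the intersection \<open>T i \<inter> X\<close>.
\<close>

lemma sum_uncross_chain_le: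
  fixes \<rho> :: "'s set \<Rightarrow> nat" and T :: "nat \<Rightarrow> 's set"
  assumes submodular: "\<And>X Y. \<rho> (X \<union> Y) + \<rho> (X \<inter> Y) \<le> \<rho> X + \<rho> Y"
    and chain: "\<And>i. T (Suc i) \<subseteq> T i"
    and top: "T 0 = UNIV"
  shows "(\<Sum>i<n. \<rho> (T (Suc i) \<union> (T i \<inter> X))) + \<rho> (T n \<inter> X)
         \<le> \<rho> X + (\<Sum>i<n. \<rho> (T (Suc i)))"
proof (induction n)
  case 0
  then show ?case by (simp add: top)
next
  case (Suc n)
  have "T (Suc n) \<inter> (T n \<inter> X) = T (Suc n) \<inter> X"
    using chain by blast
  then show ?case
    using Suc submodular[of "T (Suc n)" "T n \<inter> X"] by simp
qed

lemma sum_threshold_sets_le: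
  fixes \<rho> :: "'s set \<Rightarrow> nat" and F :: "'c \<Rightarrow> 's set"
  assumes empty: "\<rho> {} = 0"
    and submodular: "\<And>X Y. \<rho> (X \<union> Y) + \<rho> (X \<inter> Y) \<le> \<rho> X + \<rho> Y"
    and "finite C"
  shows "(\<Sum>i=1..n. \<rho> {e. i \<le> card {c \<in> C. e \<in> F c}}) \<le> (\<Sum>c\<in>C. \<rho> (F c))"
  using \<open>finite C\<close>
proof (induction C)
  case empty
  then show ?case by (simp add: assms(1))
next
  case (insert c C)
  define T where "T i = {e. i \<le> card {c \<in> C. e \<in> F c}}" for i
  have card_insert: "card {d \<in> insert c C. e \<in> F d}
      = (if e \<in> F c then Suc (card {d \<in> C. e \<in> F d}) else card {d \<in> C. e \<in> F d})" for e
  proof -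
    have "{d \<in> insert c C. e \<in> F d}
        = (if e \<in> F c then insert c {d \<in> C. e \<in> F d} else {d \<in> C. e \<in> F d})"
      by auto
    then show ?thesis using insert.hyps by simp
  qed
  have threshold: "{e. Suc i \<le> card {d \<in> insert c C. e \<in> F d}} = T (Suc i) \<union> (T i \<inter> F c)" for i
    unfolding card_insert T_def by (auto split: if_splits)
  have shift: "(\<Sum>i=1..n. g i) = (\<Sum>i<n. g (Suc i))" for g :: "nat \<Rightarrow> nat"
    by (rule sum.reindex_bij_witness[of _ Suc "\<lambda>i. i - 1"]) auto
  have "(\<Sum>i=1..n. \<rho> {e. i \<le> card {d \<in> insert c C. e \<in> F d}})
      = (\<Sum>i<n. \<rho> (T (Suc i) \<union> (T i \<inter> F c)))"
    unfolding shift threshold ..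
  also have "\<dots> \<le> \<rho> (F c) + (\<Sum>i<n. \<rho> (T (Suc i)))"
  proof -
    have "T (Suc i) \<subseteq> T i" for i by (auto simp: T_def)
    moreover have "T 0 = UNIV" by (simp add: T_def)
    ultimately show ?thesis
      using submodular by (intro add_leD1[OF sum_uncross_chain_le])
  qed
  also have "\<dots> \<le> \<rho> (F c) + (\<Sum>d\<in>C. \<rho> (F d))"
    using insert.IH unfolding shift T_def by simp
  finally show ?case using insert.hyps by simp
qed

section \<open>The rank function of a matroid\<close>

context matroid
begin

lemma finite_indep: "indep X \<Longrightarrow> finite X"
  using indep_subset_ground finite_ground finite_subset by blast

lemma finite_indep_cards: "finite {card X | X. X \<subseteq> A \<and> indep X}"
proof -
  have "{card X | X. X \<subseteq> A \<and> indep X} \<subseteq> card ` Pow E"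
    using indep_subset_ground by auto
  then show ?thesis using finite_ground finite_subset by blast
qed

lemma card_le_rank: "X \<subseteq> A \<Longrightarrow> indep X \<Longrightarrow> card X \<le> matroid_rank indep A"
  unfolding matroid_rank_def by (rule Max_ge[OF finite_indep_cards]) blast

lemma rank_attained:
  obtains X where "X \<subseteq> A" "indep X" "card X = matroid_rank indep A"
proof -
  have "{card X | X. X \<subseteq> A \<and> indep X} \<noteq> {}" using indep_empty by blast
  then have "matroid_rank indep A \<in> {card X | X. X \<subseteq> A \<and> indep X}"
    unfolding matroid_rank_def by (rule Max_in[OF finite_indep_cards])
  then show ?thesis using that by auto
qed

lemma rank_le_card: "finite A \<Longrightarrow> matroid_rank indep A \<le> card A"
  by (metis rank_attained card_mono)

lemma rank_empty: "matroid_rank indep {} = 0"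
  using rank_le_card[of "{}"] by simp

lemma rank_mono: "A \<subseteq> B \<Longrightarrow> matroid_rank indep A \<le> matroid_rank indep B"
  by (metis rank_attained card_le_rank order_trans)

lemma indep_if_rank_eq_card:
  assumes "finite A" "card A \<le> matroid_rank indep A"
  shows "indep A"
  by (metis assms rank_attained card_seteq)

lemma extend_to_basis:
  assumes "X \<subseteq> A" "indep X"
  obtains B where "X \<subseteq> B" "B \<subseteq> A" "indep B" "card B = matroid_rank indep A"
proof -
  let ?P = "\<lambda>B. X \<subseteq> B \<and> B \<subseteq> A \<and> indep B"
  have "?P X" using assms by simp
  moreover have "\<forall>B. ?P B \<longrightarrow> card B < Suc (matroid_rank indep A)"
    using card_le_rank by (simp add: less_Suc_eq_le)
  ultimately have "\<exists>B. ?P B \<and> (\<forall>B'. ?P B' \<longrightarrow> card B' \<le> card B)"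
    by (rule ex_has_greatest_nat)
  then obtain B where B: "?P B" and maximal: "\<And>B'. ?P B' \<Longrightarrow> card B' \<le> card B"
    by blast
  have "matroid_rank indep A \<le> card B"
  proof (rule ccontr)
    assume "\<not> matroid_rank indep A \<le> card B"
    then obtain Y where "Y \<subseteq> A" "indep Y" "card B < card Y"
      by (metis rank_attained not_le)
    then obtain y where "y \<in> Y - B" "indep (insert y B)"
      using indep_augment B by blast
    then show False
      using maximal[of "insert y B"] B \<open>Y \<subseteq> A\<close> finite_indep[of B] by auto
  qed
  then show ?thesis using that B card_le_rank by (meson le_antisym)
qed

text \<open>
  If \<open>B\<close> is a basis of \<open>X \<union> Y\<close> that contains a basis of \<open>X \<inter> Y\<close>, then \<open>B \<inter> X\<close> and \<open>B \<inter> Y\<close>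
  are independent, and together they count every element of \<open>B\<close> once and those in
  \<open>X \<inter> Y\<close> twice.
\<close>

lemma rank_submodular:
  "matroid_rank indep (X \<union> Y) + matroid_rank indep (X \<inter> Y)
   \<le> matroid_rank indep X + matroid_rank indep Y"
proof -
  obtain D where D: "D \<subseteq> X \<inter> Y" "indep D" "card D = matroid_rank indep (X \<inter> Y)"
    by (rule rank_attained)
  then obtain B where B: "D \<subseteq> B" "B \<subseteq> X \<union> Y" "indep B" "card B = matroid_rank indep (X \<union> Y)"
    using extend_to_basis[of D "X \<union> Y"] by blast
  have fin: "finite B" using B(3) by (rule finite_indep)
  have "card B + card D \<le> card (B \<inter> X \<union> B \<inter> Y) + card ((B \<inter> X) \<inter> (B \<inter> Y))"
  proof (rule add_mono)
    show "card B \<le> card (B \<inter> X \<union> B \<inter> Y)"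
      using B(2) fin by (intro card_mono) auto
    show "card D \<le> card ((B \<inter> X) \<inter> (B \<inter> Y))"
      using B(1) D(1) fin by (intro card_mono) auto
  qed
  also have "\<dots> = card (B \<inter> X) + card (B \<inter> Y)"
    using fin by (intro card_Un_Int[symmetric]) auto
  also have "\<dots> \<le> matroid_rank indep X + matroid_rank indep Y"
    using B(3) by (intro add_mono card_le_rank) (auto intro: indep_subset)
  finally show ?thesis using B(4) D(3) by simp
qed

section \<open>Coloring from a fixed list assignment\<close>

lemma rank_sum_if_colorable:
  assumes "colorable_from_lists E indep w L"
    and C: "finite C" "\<And>e. e \<in> E \<Longrightarrow> L e \<subseteq> C"
    and A: "A \<subseteq> E"
  shows "(\<Sum>e\<in>A. w e) \<le> (\<Sum>c\<in>C. matroid_rank indep {e \<in> A. c \<in> L e})"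
proof -
  obtain L' where L': "\<And>e. e \<in> E \<Longrightarrow> L' e \<subseteq> L e" "\<And>e. e \<in> E \<Longrightarrow> card (L' e) = w e"
    and indep_class: "\<And>c. indep {e \<in> E. c \<in> L' e}"
    using assms(1) unfolding colorable_from_lists_def by blast
  have fin: "finite A" using A finite_ground finite_subset by blast
  have "(\<Sum>e\<in>A. w e) = (\<Sum>e\<in>A. card {c \<in> C. c \<in> L' e})"
  proof (rule sum.cong[OF refl])
    fix e assume "e \<in> A"
    then have "{c \<in> C. c \<in> L' e} = L' e" using A C(2) L'(1) by blast
    then show "w e = card {c \<in> C. c \<in> L' e}" using L'(2) A \<open>e \<in> A\<close> by auto
  qed
  also have "\<dots> = (\<Sum>c\<in>C. card {e \<in> A. c \<in> L' e})"
    using fin C(1) by (intro sum_multicount_gen) auto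
  also have "\<dots> \<le> (\<Sum>c\<in>C. matroid_rank indep {e \<in> A. c \<in> L e})"
  proof (intro sum_mono card_le_rank)
    fix c
    show "{e \<in> A. c \<in> L' e} \<subseteq> {e \<in> A. c \<in> L e}" using A L'(1) by blast
    show "indep {e \<in> A. c \<in> L' e}"
      using A by (intro indep_subset[OF indep_class[of c]]) blast
  qed
  finally show ?thesis .
qed

text \<open>
  Rado's theorem is applied to the copies \<open>(e, k)\<close>, \<open>k < w e\<close>, each with the candidates
  \<open>L e \<times> {e}\<close>, and to the function \<open>\<rho>\<close> that adds up the ranks of the color classes of a set of
  pairs. The transversal \<open>X\<close> that it provides has \<open>card I \<le> \<rho> X \<le> card X \<le> card I\<close>. Equality
  on the right says that the copies choose distinct pairs, equality in the middle that every
  color class of \<open>X\<close> is independent.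
\<close>

lemma colorable_if_rank_sum:
  assumes C: "finite C" "\<And>e. e \<in> E \<Longrightarrow> L e \<subseteq> C"
    and rank_sum: "\<And>A. A \<subseteq> E \<Longrightarrow>
      (\<Sum>e\<in>A. w e) \<le> (\<Sum>c\<in>C. matroid_rank indep {e \<in> A. c \<in> L e})"
  shows "colorable_from_lists E indep w L"
proof -
  define I where "I = (SIGMA e:E. {..<w e})"
  define \<rho> where "\<rho> X = (\<Sum>c\<in>C. matroid_rank indep {e. (c, e) \<in> X})" for X
  have finite_I: "finite I" unfolding I_def using finite_ground by blast
  have "\<exists>f. (\<forall>p\<in>I. f p \<in> L (fst p) \<times> {fst p}) \<and> (\<forall>J\<subseteq>I. card J \<le> \<rho> (f ` J))"
  proof (rule rado_transversal)
    show "\<rho> {} = 0" by (simp add: \<rho>_def rank_empty)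
    show "\<rho> X \<le> \<rho> Y" if "X \<subseteq> Y" for X Y
      unfolding \<rho>_def using that by (intro sum_mono rank_mono) blast
    show "\<rho> (X \<union> Y) + \<rho> (X \<inter> Y) \<le> \<rho> X + \<rho> Y" for X Y
    proof -
      have "{e. (c, e) \<in> X \<union> Y} = {e. (c, e) \<in> X} \<union> {e. (c, e) \<in> Y}"
        and "{e. (c, e) \<in> X \<inter> Y} = {e. (c, e) \<in> X} \<inter> {e. (c, e) \<in> Y}" for c
        by auto
      then show ?thesis
        unfolding \<rho>_def sum.distrib[symmetric] by (intro sum_mono) (simp add: rank_submodular)
    qed
    show "finite I" by fact
    show "finite (L (fst p) \<times> {fst p})" if "p \<in> I" for p
      using that finite_subset[OF C(2,1)] unfolding I_def by auto
    show "card J \<le> \<rho> (\<Union>p\<in>J. L (fst p) \<times> {fst p})" if "J \<subseteq> I" for J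
    proof -
      have "fst ` J \<subseteq> E" using that unfolding I_def by auto
      then have finite_fst: "finite (fst ` J)" using finite_ground finite_subset by blast
      have "J \<subseteq> (SIGMA e:fst ` J. {..<w e})"
        using that unfolding I_def by force
      then have "card J \<le> card (SIGMA e:fst ` J. {..<w e})"
        using finite_fst by (intro card_mono) auto
      also have "\<dots> = (\<Sum>e\<in>fst ` J. w e)"
        using finite_fst by simp
      also have "\<dots> \<le> (\<Sum>c\<in>C. matroid_rank indep {e \<in> fst ` J. c \<in> L e})"
        using rank_sum \<open>fst ` J \<subseteq> E\<close> .
      also have "\<dots> = \<rho> (\<Union>p\<in>J. L (fst p) \<times> {fst p})"
      proof -
        have "{e \<in> fst ` J. c \<in> L e} = {e. (c, e) \<in> (\<Union>p\<in>J. L (fst p) \<times> {fst p})}" for c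
          by force
        then show ?thesis unfolding \<rho>_def by simp
      qed
      finally show ?thesis .
    qed
  qed
  then obtain f where f: "\<And>p. p \<in> I \<Longrightarrow> f p \<in> L (fst p) \<times> {fst p}"
    and "card I \<le> \<rho> (f ` I)" by blast
  define X where "X = f ` I"
  have X_subset: "c \<in> L e \<and> e \<in> E" if "(c, e) \<in> X" for c e
    using that f unfolding X_def I_def by force
  have finite_class: "finite {e. (c, e) \<in> X}" for c
    using X_subset finite_ground by (auto intro: finite_subset[of _ E])
  have "(SIGMA c:C. {e. (c, e) \<in> X}) = X"
    using X_subset C(2) by force
  then have card_X: "card X = (\<Sum>c\<in>C. card {e. (c, e) \<in> X})"
    using card_SigmaI[of C "\<lambda>c. {e. (c, e) \<in> X}"] C(1) finite_class by simp
  have rank_le: "matroid_rank indep {e. (c, e) \<in> X} \<le> card {e. (c, e) \<in> X}" for c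
    using finite_class by (rule rank_le_card)
  then have "\<rho> X \<le> card X"
    unfolding \<rho>_def card_X by (rule sum_mono)
  moreover have "card X \<le> card I"
    unfolding X_def using finite_I by (rule card_image_le)
  moreover have "card I \<le> \<rho> X"
    unfolding X_def by fact
  ultimately have "card X = card I" and "\<rho> X = card X" by auto
  have inj: "inj_on f I"
    using \<open>card X = card I\<close> finite_I unfolding X_def by (simp add: eq_card_imp_inj_on)
  have rank_class: "matroid_rank indep {e. (c, e) \<in> X} = card {e. (c, e) \<in> X}" if "c \<in> C" for c
    using sum_mono_inv[OF \<open>\<rho> X = card X\<close>[unfolded \<rho>_def card_X] rank_le that C(1)] .
  show ?thesis
    unfolding colorable_from_lists_def
  proof (intro exI[of _ "\<lambda>e. {c. (c, e) \<in> X}"] conjI ballI allI)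
    fix e assume e: "e \<in> E"
    show "{c. (c, e) \<in> X} \<subseteq> L e" using X_subset by blast
    then show "finite {c. (c, e) \<in> X}" using C e by (meson finite_subset)
    have "f ` ({e} \<times> {..<w e}) = {c. (c, e) \<in> X} \<times> {e}"
    proof (intro equalityI subsetI)
      fix q assume "q \<in> f ` ({e} \<times> {..<w e})"
      then obtain k where "k < w e" "q = f (e, k)" by auto
      moreover from this have "(e, k) \<in> I" using e unfolding I_def by simp
      ultimately show "q \<in> {c. (c, e) \<in> X} \<times> {e}"
        using f[of "(e, k)"] unfolding X_def by (auto simp: image_iff) metis
    next
      fix q assume "q \<in> {c. (c, e) \<in> X} \<times> {e}"
      then obtain c where "q = (c, e)" "(c, e) \<in> X" by auto
      then obtain p where p: "p \<in> I" "f p = (c, e)" unfolding X_def by (metis imageE)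
      then have "fst p = e" using f[of p] by auto
      then have "p \<in> {e} \<times> {..<w e}" using p unfolding I_def by auto
      then show "q \<in> f ` ({e} \<times> {..<w e})" using p \<open>q = (c, e)\<close> by (metis imageI)
    qed
    moreover have "inj_on f ({e} \<times> {..<w e})"
      using inj e unfolding I_def by (auto intro: inj_on_subset)
    ultimately have "card ({c. (c, e) \<in> X} \<times> {e}) = card ({e} \<times> {..<w e})"
      by (metis card_image)
    then show "card {c. (c, e) \<in> X} = w e"
      by (simp add: card_cartesian_product)
  next
    fix c
    have eq: "{e \<in> E. c \<in> {c. (c, e) \<in> X}} = {e. (c, e) \<in> X}"
      using X_subset by blast
    show "indep {e \<in> E. c \<in> {c. (c, e) \<in> X}}"
    proof (cases "c \<in> C")
      case True
      then show ?thesis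
        unfolding eq using rank_class finite_class by (simp add: indep_if_rank_eq_card)
    next
      case False
      then have "{e. (c, e) \<in> X} = {}" using X_subset C(2) by blast
      then show ?thesis unfolding eq using indep_empty by simp
    qed
  qed
qed

lemma colorable_iff_rank_sum:
  assumes "finite C" "\<And>e. e \<in> E \<Longrightarrow> L e \<subseteq> C"
  shows "colorable_from_lists E indep w L \<longleftrightarrow>
    (\<forall>A\<subseteq>E. (\<Sum>e\<in>A. w e) \<le> (\<Sum>c\<in>C. matroid_rank indep {e \<in> A. c \<in> L e}))"
  using rank_sum_if_colorable[of w L C] colorable_if_rank_sum[of C L w] assms by blast

section \<open>Initial segments are the worst lists\<close>

text \<open>
  An element of \<open>A\<close> lies in exactly \<open>l e\<close> of the color classes \<open>{e \<in> A. c \<in> L e}\<close>, so the sets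
  on the left are the threshold sets of the family of color classes.
\<close>

lemma initial_segments_minimize_rank_sum:
  assumes L: "list_assignment_of_size E l L"
    and C: "finite C" "\<And>e. e \<in> E \<Longrightarrow> L e \<subseteq> C"
    and A: "A \<subseteq> E"
  shows "(\<Sum>i=1..n. matroid_rank indep {e \<in> A. i \<le> l e})
         \<le> (\<Sum>c\<in>C. matroid_rank indep {e \<in> A. c \<in> L e})"
proof -
  have threshold: "{e. i \<le> card {c \<in> C. e \<in> {e \<in> A. c \<in> L e}}} = {e \<in> A. i \<le> l e}"
    if "i \<ge> 1" for i
  proof -
    have "card {c \<in> C. e \<in> {e \<in> A. c \<in> L e}} = (if e \<in> A then l e else 0)" for e
    proof (cases "e \<in> A")
      case True
      then have "{c \<in> C. e \<in> {e \<in> A. c \<in> L e}} = L e" using A C(2) by auto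
      then show ?thesis
        using L True A unfolding list_assignment_of_size_def by auto
    qed simp
    then show ?thesis using that by auto
  qed
  have "(\<Sum>i=1..n. matroid_rank indep {e. i \<le> card {c \<in> C. e \<in> {e \<in> A. c \<in> L e}}})
      \<le> (\<Sum>c\<in>C. matroid_rank indep {e \<in> A. c \<in> L e})"
    by (rule sum_threshold_sets_le[OF rank_empty rank_submodular C(1)])
  then show ?thesis using threshold by simp
qed

end

theorem theorem2p7:
  fixes E :: "'a set" and indep :: "'a set \<Rightarrow> bool"
    and l :: "'a \<Rightarrow> nat" and w :: "'a \<Rightarrow> nat"
  assumes "matroid E indep"
  shows "((\<forall>A\<subseteq>E. (\<Sum>\<^sub>\<infinity>i\<in>{1..}. matroid_rank indep {e \<in> A. l e \<ge> i}) \<ge> (\<Sum>e\<in>A. w e))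
           \<longleftrightarrow> colorable_from_lists E indep w (\<lambda>e. {1..l e}))
       \<and> (colorable_from_lists E indep w (\<lambda>e. {1..l e})
           \<longleftrightarrow> (\<forall>L. list_assignment_of_size E l L \<longrightarrow> colorable_from_lists E indep w L))"
proof -
  interpret matroid E indep by fact
  \<comment> \<open>Any common upper bound of the list sizes would do.\<close>
  define n where "n = (\<Sum>e\<in>E. l e)"
  have l_le: "l e \<le> n" if "e \<in> E" for e
    unfolding n_def using that finite_ground by (simp add: member_le_sum)
  have infsum_eq: "(\<Sum>\<^sub>\<infinity>i\<in>{1..}. matroid_rank indep {e \<in> A. l e \<ge> i})
      = (\<Sum>i=1..n. matroid_rank indep {e \<in> A. i \<le> l e})" if "A \<subseteq> E" for A
    using that l_le by (intro infsum_rank_eq_sum) blast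
  have initial_iff: "colorable_from_lists E indep w (\<lambda>e. {1..l e}) \<longleftrightarrow>
      (\<forall>A\<subseteq>E. (\<Sum>e\<in>A. w e) \<le> (\<Sum>i=1..n. matroid_rank indep {e \<in> A. i \<le> l e}))"
    using l_le by (subst colorable_iff_rank_sum[of "{1..n}"]) force+
  have any_lists: "colorable_from_lists E indep w L"
    if initial: "colorable_from_lists E indep w (\<lambda>e. {1..l e})"
      and L: "list_assignment_of_size E l L" for L
  proof (rule colorable_if_rank_sum)
    show "finite (\<Union>e\<in>E. L e)"
      using L finite_ground unfolding list_assignment_of_size_def by blast
    show "L e \<subseteq> (\<Union>e\<in>E. L e)" if "e \<in> E" for e
      using that by blast
    fix A assume A: "A \<subseteq> E"
    have "(\<Sum>e\<in>A. w e) \<le> (\<Sum>i=1..n. matroid_rank indep {e \<in> A. i \<le> l e})"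
      using initial A unfolding initial_iff by blast
    also have "\<dots> \<le> (\<Sum>c\<in>(\<Union>e\<in>E. L e). matroid_rank indep {e \<in> A. c \<in> L e})"
      using \<open>finite (\<Union>e\<in>E. L e)\<close> A by (intro initial_segments_minimize_rank_sum[OF L]) auto
    finally show "(\<Sum>e\<in>A. w e) \<le> (\<Sum>c\<in>(\<Union>e\<in>E. L e). matroid_rank indep {e \<in> A. c \<in> L e})" .
  qed
  have "list_assignment_of_size E l (\<lambda>e. {1..l e})"
    unfolding list_assignment_of_size_def by simp
  then show ?thesis
    using any_lists initial_iff infsum_eq by auto
qed

end
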